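(* Let $(F^4,g)$ be the Riemannian manifold described in the context, with global coordinates $(x,y,s,t)$, $t>0$. Let $c_1,\dots,c_5\in\mathbb{R}$ be any constants and let $$\begin{aligned} \xi={}&\tfrac12\left[(c_2-12)x+2c_3\,y+2c_5\right]\frac{\partial}{\partial x} -\tfrac12\left[c_1\,x+(c_2+12)y-2c_4\right]\frac{\partial}{\partial y}\\ &+\tfrac12\left[c_1(s^2-t^2)+2c_2\,s+2c_3\right]\frac{\partial}{\partial s} +(c_1\,s+c_2)\,t\,\frac{\partial}{\partial t} \end{aligned}$$ (the Ricci soliton vector fields of $(F^4,g)$). Then $\xi$ is non-gradient: there is no smooth function $f\in C^\infty(F^4)$ such that $\xi=\mathrm{grad} f$, the gradient being taken with respect to $g$.
   Context: $F^4=\mathbb{R}^2\times\mathbb{H}^2$ with global coordinates $(x,y,s,t)$, where $(x,y)\in\mathbb{R}^2$ and $(s,t)$, $t>0$, are upper half-plane coordinates on $\mathbb{H}^2$. The Riemannian metric is $g=\theta_1^2+\theta_2^2+\theta_3^2+\theta_4^2$ with $$\theta_1=\tfrac{1}{\sqrt t}dx-\tfrac{s}{\sqrt t}dy,\quad \theta_2=\sqrt t\,dy,\quad \theta_3=\tfrac{1}{2t}ds,\quad \theta_4=\tfrac{1}{2t}dt.$$ A Ricci soliton vector field is a smooth vector field $\xi$ with $\mathrm{Ric}+\frac12\mathcal{L}_\xi g=\lambda g$ for some constant $\lambda\in\mathbb{R}$. *)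

theory Defs
  imports "HOL-Analysis.Analysis"
begin

text \<open>
  \<^term>\<open>Ck_on k f S\<close>: \<open>f\<close> is of class \<open>C\<^sup>k\<close> on the open set \<open>S\<close>.
  The derivative is handled through its values in all (constant) directions, so that
  every level of the recursion concerns a scalar function.
\<close>

primrec Ck_on :: "nat \<Rightarrow> ('a::euclidean_space \<Rightarrow> real) \<Rightarrow> 'a set \<Rightarrow> bool" where
  "Ck_on 0 f S \<longleftrightarrow> continuous_on S f"
| "Ck_on (Suc k) f S \<longleftrightarrow>
     f differentiable_on S \<and> (\<forall>v. Ck_on k (\<lambda>p. frechet_derivative f (at p) v) S)"

definition smooth_on :: "('a::euclidean_space \<Rightarrow> real) \<Rightarrow> 'a set \<Rightarrow> bool" where
  "smooth_on f S \<longleftrightarrow> (\<forall>k. Ck_on k f S)"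

text \<open>
  A Riemannian metric on an open subset of a Euclidean space is given as
  \<open>g p u v\<close>, with \<open>u\<close>, \<open>v\<close> tangent vectors at \<open>p\<close>. The gradient is
  the vector field dual to the differential: \<open>g (grad f, w) = df w\<close> for all \<open>w\<close>.
\<close>

definition gradient ::
  "('a::euclidean_space \<Rightarrow> 'a \<Rightarrow> 'a \<Rightarrow> real) \<Rightarrow> ('a \<Rightarrow> real) \<Rightarrow> 'a \<Rightarrow> 'a" where
  "gradient g f p = (THE v. \<forall>w. g p v w = frechet_derivative f (at p) w)"

text \<open>
  Points of \<open>F\<^sup>4\<close> are vectors with components \<open>(p $ 1, p $ 2, p $ 3, p $ 4) = (x, y, s, t)\<close>,
  and tangent vectors are given by their components with respect to the coordinate frame
  \<open>\<partial>/\<partial>x, \<partial>/\<partial>y, \<partial>/\<partial>s, \<partial>/\<partial>t\<close>.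
\<close>

definition F4 :: "(real^4) set" where
  "F4 = {p. p $ 4 > 0}"

definition theta1 :: "real^4 \<Rightarrow> real^4 \<Rightarrow> real" where
  "theta1 p v = 1 / sqrt (p $ 4) * v $ 1 - p $ 3 / sqrt (p $ 4) * v $ 2"

definition theta2 :: "real^4 \<Rightarrow> real^4 \<Rightarrow> real" where
  "theta2 p v = sqrt (p $ 4) * v $ 2"

definition theta3 :: "real^4 \<Rightarrow> real^4 \<Rightarrow> real" where
  "theta3 p v = 1 / (2 * p $ 4) * v $ 3"

definition theta4 :: "real^4 \<Rightarrow> real^4 \<Rightarrow> real" where
  "theta4 p v = 1 / (2 * p $ 4) * v $ 4"

definition F4_metric :: "real^4 \<Rightarrow> real^4 \<Rightarrow> real^4 \<Rightarrow> real" where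
  "F4_metric p u v =
     theta1 p u * theta1 p v + theta2 p u * theta2 p v +
     theta3 p u * theta3 p v + theta4 p u * theta4 p v"

definition F4_soliton_field ::
  "real \<Rightarrow> real \<Rightarrow> real \<Rightarrow> real \<Rightarrow> real \<Rightarrow> real^4 \<Rightarrow> real^4" where
  "F4_soliton_field c1 c2 c3 c4 c5 p =
     (let x = p $ 1; y = p $ 2; s = p $ 3; t = p $ 4 in
       vector [1/2 * ((c2 - 12) * x + 2 * c3 * y + 2 * c5),
               - (1/2) * (c1 * x + (c2 + 12) * y - 2 * c4),
               1/2 * (c1 * (s^2 - t^2) + 2 * c2 * s + 2 * c3),
               (c1 * s + c2) * t])"

text \<open>
  The metric is nondegenerate on \<open>F\<^sup>4\<close>, so the definite description in
  \<^const>\<open>gradient\<close> denotes at every point of differentiability.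
\<close>

lemma open_F4: "open F4"
  unfolding F4_def by (intro open_Collect_less continuous_intros)

lemma vector_four [simp]:
  "(vector [a, b, c, d] :: 'a::zero^4) $ 1 = a"
  "(vector [a, b, c, d] :: 'a::zero^4) $ 2 = b"
  "(vector [a, b, c, d] :: 'a::zero^4) $ 3 = c"
  "(vector [a, b, c, d] :: 'a::zero^4) $ 4 = d"
  by (simp_all add: vector_def)

lemma F4_metric_pos:
  assumes "p \<in> F4" "v \<noteq> 0"
  shows "F4_metric p v v > 0"
proof (rule ccontr)
  assume "\<not> ?thesis"
  then have "theta1 p v ^ 2 + theta2 p v ^ 2 + theta3 p v ^ 2 + theta4 p v ^ 2 \<le> 0"
    by (simp add: F4_metric_def power2_eq_square)
  moreover have "theta1 p v ^ 2 \<ge> 0" "theta2 p v ^ 2 \<ge> 0" "theta3 p v ^ 2 \<ge> 0" "theta4 p v ^ 2 \<ge> 0"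
    by simp_all
  ultimately have "theta1 p v ^ 2 = 0 \<and> theta2 p v ^ 2 = 0 \<and> theta3 p v ^ 2 = 0 \<and> theta4 p v ^ 2 = 0"
    by linarith
  with assms(1) have "v $ 1 = 0 \<and> v $ 2 = 0 \<and> v $ 3 = 0 \<and> v $ 4 = 0"
    by (auto simp: F4_def theta1_def theta2_def theta3_def theta4_def)
  with assms(2) show False
    by (simp add: vec_eq_iff forall_4)
qed

lemma F4_metric_riesz:
  assumes p: "p \<in> F4" and L: "linear L"
  shows "\<exists>!v. \<forall>w. F4_metric p v w = L w"
proof (rule ex_ex1I)
  from p have t: "p $ 4 > 0" by (simp add: F4_def)
  define E1 :: "real^4" where "E1 = vector [sqrt (p $ 4), 0, 0, 0]"
  define E2 :: "real^4" where "E2 = vector [p $ 3 / sqrt (p $ 4), 1 / sqrt (p $ 4), 0, 0]"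
  define E3 :: "real^4" where "E3 = vector [0, 0, 2 * p $ 4, 0]"
  define E4 :: "real^4" where "E4 = vector [0, 0, 0, 2 * p $ 4]"
  note E = E1_def E2_def E3_def E4_def
  note th = theta1_def theta2_def theta3_def theta4_def
  define v where "v = L E1 *\<^sub>R E1 + L E2 *\<^sub>R E2 + L E3 *\<^sub>R E3 + L E4 *\<^sub>R E4"
  have tv: "theta1 p v = L E1" "theta2 p v = L E2" "theta3 p v = L E3" "theta4 p v = L E4"
    using t by (simp_all add: v_def th E1_def[symmetric] E2_def[symmetric])
      (simp_all add: E field_simps)
  have "F4_metric p v w = L w" for w
  proof -
    have w: "w = theta1 p w *\<^sub>R E1 + theta2 p w *\<^sub>R E2 + theta3 p w *\<^sub>R E3 + theta4 p w *\<^sub>R E4"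
      using t by (simp add: vec_eq_iff forall_4 E th) (simp add: field_simps)
    have "L w = L (theta1 p w *\<^sub>R E1 + theta2 p w *\<^sub>R E2 + theta3 p w *\<^sub>R E3 + theta4 p w *\<^sub>R E4)"
      using w by simp
    also have "\<dots> = F4_metric p v w"
      by (simp add: linear_add[OF L] linear_scale[OF L] F4_metric_def tv mult.commute)
    finally show ?thesis by simp
  qed
  then show "\<exists>v. \<forall>w. F4_metric p v w = L w" by blast
next
  fix u v assume "\<forall>w. F4_metric p u w = L w" "\<forall>w. F4_metric p v w = L w"
  then have "F4_metric p u (u - v) = F4_metric p v (u - v)" by simp
  moreover have "F4_metric p (u - v) w = F4_metric p u w - F4_metric p v w" for w
  proof -
    have "theta1 p (u - v) = theta1 p u - theta1 p v" "theta2 p (u - v) = theta2 p u - theta2 p v"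
      "theta3 p (u - v) = theta3 p u - theta3 p v" "theta4 p (u - v) = theta4 p u - theta4 p v"
      by (simp_all add: theta1_def theta2_def theta3_def theta4_def right_diff_distrib diff_divide_distrib)
    then show ?thesis
      by (simp add: F4_metric_def left_diff_distrib)
  qed
  ultimately have "F4_metric p (u - v) (u - v) = 0" by simp
  then show "u = v"
    using F4_metric_pos[OF p, of "u - v"] by fastforce
qed

lemma F4_metric_gradient:
  assumes "p \<in> F4" "f differentiable (at p)"
  shows "F4_metric p (gradient F4_metric f p) w = frechet_derivative f (at p) w"
  using theI'[OF F4_metric_riesz[OF assms(1) linear_frechet_derivative[OF assms(2)]]]
  unfolding gradient_def by blast

end

theory Submission
  imports Defs
begin

text \<open>
  If \<open>\<xi> = grad f\<close>, then \<open>df = g(\<xi>, \<cdot>)\<close> has \<open>dt\<close>-coefficient \<open>(c\<^sub>1 s + c\<^sub>2) / (4 t)\<close>,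
  which does not depend on \<open>x\<close>, while its \<open>dx\<close>-coefficient is \<open>u / t\<close> with
  \<open>u = \<xi>\<^sub>1 - s \<xi>\<^sub>2\<close> free of \<open>t\<close>. Equality of mixed partials then forces
  \<open>u = 0\<close> identically; its coefficients at \<open>x\<close> and at \<open>s y\<close> give \<open>c\<^sub>2 = 12\<close> and
  \<open>c\<^sub>2 = -12\<close>.
\<close>

lemma smooth_on_differentiable_at:
  assumes "smooth_on f S" "open S" "p \<in> S"
  shows "f differentiable (at p)"
proof -
  from assms(1) have "Ck_on (Suc 0) f S"
    unfolding smooth_on_def by blast
  then have "f differentiable_on S" by simp
  with assms(2,3) show ?thesis
    using differentiable_on_eq_differentiable_at by blast
qed

lemma has_real_derivative_along_line:
  fixes f :: "'a::real_normed_vector \<Rightarrow> real"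
  assumes "f differentiable (at (p + r *\<^sub>R e))"
  shows "((\<lambda>r. f (p + r *\<^sub>R e)) has_real_derivative
           frechet_derivative f (at (p + r *\<^sub>R e)) e) (at r)"
proof -
  have "(f has_derivative frechet_derivative f (at (p + r *\<^sub>R e))) (at (p + r *\<^sub>R e))"
    using assms frechet_derivative_works by blast
  moreover have "((\<lambda>r. p + r *\<^sub>R e) has_derivative (\<lambda>h. h *\<^sub>R e)) (at r)"
    by (auto intro!: derivative_eq_intros)
  ultimately have "((\<lambda>r. f (p + r *\<^sub>R e)) has_derivative
      (\<lambda>h. frechet_derivative f (at (p + r *\<^sub>R e)) (h *\<^sub>R e))) (at r)"
    using has_derivative_compose by blast
  then show ?thesis
    unfolding has_field_derivative_def
    using linear_scale[OF linear_frechet_derivative[OF assms]]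
    by (simp add: mult.commute[of _ "frechet_derivative f (at (p + r *\<^sub>R e)) e"])
qed

text \<open>These are the two partial derivatives that the mixed-partials argument compares.\<close>

lemma has_real_derivative_coordinates:
  fixes f :: "real^4 \<Rightarrow> real"
  assumes "f differentiable (at (vector [x, y, s, t]))"
  shows "((\<lambda>r. f (vector [r, y, s, t])) has_real_derivative
           frechet_derivative f (at (vector [x, y, s, t])) (axis 1 1)) (at x)"
    and "((\<lambda>r. f (vector [x, y, s, r])) has_real_derivative
           frechet_derivative f (at (vector [x, y, s, t])) (axis 4 1)) (at t)"
proof -
  \<comment> \<open>The base point has 0 in the moving slot, so the line parameter is the coordinate
    itself.\<close>
  have 1: "(vector [r, y, s, t] :: real^4) = vector [0, y, s, t] + r *\<^sub>R axis 1 1" for r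
    by (simp add: vec_eq_iff forall_4 axis_def)
  have 4: "(vector [x, y, s, r] :: real^4) = vector [x, y, s, 0] + r *\<^sub>R axis 4 1" for r
    by (simp add: vec_eq_iff forall_4 axis_def)
  show "((\<lambda>r. f (vector [r, y, s, t])) has_real_derivative
           frechet_derivative f (at (vector [x, y, s, t])) (axis 1 1)) (at x)"
    using has_real_derivative_along_line[OF assms[unfolded 1[of x]]]
    unfolding 1[symmetric] .
  show "((\<lambda>r. f (vector [x, y, s, r])) has_real_derivative
           frechet_derivative f (at (vector [x, y, s, t])) (axis 4 1)) (at t)"
    using has_real_derivative_along_line[OF assms[unfolded 4[of t]]]
    unfolding 4[symmetric] .
qed

text \<open>Among the coframe only \<open>theta1\<close> is nonzero on the x-direction; its two
  factors 1/sqrt t multiply to 1/t.\<close>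

lemma F4_metric_axis_1:
  assumes "p \<in> F4"
  shows "F4_metric p v (axis 1 1) = (v $ 1 - p $ 3 * v $ 2) / p $ 4"
  using assms
  by (simp add: F4_def F4_metric_def theta1_def theta2_def theta3_def theta4_def axis_def
      diff_divide_distrib)

lemma F4_metric_axis_4:
  "F4_metric p v (axis 4 1) = v $ 4 / (4 * (p $ 4)\<^sup>2)"
  by (simp add: F4_metric_def theta1_def theta2_def theta3_def theta4_def axis_def
      power2_eq_square)

text \<open>Symmetry of mixed partials in integrated form, using first derivatives only: since
  \<open>w\<close> is free of x, the increment of \<open>f\<close> between two heights t is constant
  in x. Its x-derivative for the heights 1 and 2 is u/2 - u, hence u = 0.\<close>

lemma F4_gradient_potential_component_eq_0:
  fixes f :: "real^4 \<Rightarrow> real" and u :: "real \<Rightarrow> real \<Rightarrow> real \<Rightarrow> real"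
  assumes diff: "\<And>p. p \<in> F4 \<Longrightarrow> f differentiable (at p)"
    and dx: "\<And>x y s t. t > 0 \<Longrightarrow>
      frechet_derivative f (at (vector [x, y, s, t])) (axis 1 1) = u x y s / t"
    and dt: "\<And>x y s t. t > 0 \<Longrightarrow>
      frechet_derivative f (at (vector [x, y, s, t])) (axis 4 1) = w s t"
  shows "u x y s = 0"
proof -
  have x_deriv: "((\<lambda>r. f (vector [r, y, s, t])) has_real_derivative u x y s / t) (at x)"
    if "t > 0" for x t
    using has_real_derivative_coordinates(1)[OF diff, of x y s t] dx that
    by (simp add: F4_def)
  have t_deriv: "((\<lambda>r. f (vector [x, y, s, r])) has_real_derivative w s t) (at t)"
    if "t > 0" for x t
    using has_real_derivative_coordinates(2)[OF diff, of x y s t] dt that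
    by (simp add: F4_def)
  define D where "D r = f (vector [r, y, s, 2]) - f (vector [r, y, s, 1])" for r
  have "D r = D 0" for r
  proof -
    \<comment> \<open>Both terms have the same t-derivative \<open>w s t\<close>, so
      \<open>G\<close> is constant on [1, 2], which says \<open>D r = D 0\<close>.\<close>
    define G where "G t = f (vector [r, y, s, t]) - f (vector [0, y, s, t])" for t
    have "(G has_real_derivative 0) (at t)" if "t > 0" for t
      unfolding G_def using DERIV_diff[OF t_deriv t_deriv] that by fastforce
    then have "G 2 = G 1"
      by (intro DERIV_isconst_end[of 1 2 G] continuous_at_imp_continuous_on)
        (auto intro: DERIV_isCont[of G 0])
    then show ?thesis by (simp add: G_def D_def)
  qed
  then have "(D has_real_derivative 0) (at x)"
    by (metis DERIV_const ext)
  moreover have "(D has_real_derivative u x y s / 2 - u x y s / 1) (at x)"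
    unfolding D_def by (intro DERIV_diff x_deriv) simp_all
  ultimately show ?thesis
    using DERIV_unique by fastforce
qed

theorem proposition2p4:
  fixes c1 c2 c3 c4 c5 :: real
  shows "\<not> (\<exists>f. smooth_on f F4 \<and>
            (\<forall>p\<in>F4. F4_soliton_field c1 c2 c3 c4 c5 p = gradient F4_metric f p))"
proof
  assume "\<exists>f. smooth_on f F4 \<and>
            (\<forall>p\<in>F4. F4_soliton_field c1 c2 c3 c4 c5 p = gradient F4_metric f p)"
  then obtain f where smooth: "smooth_on f F4"
    and grad: "\<And>p. p \<in> F4 \<Longrightarrow> F4_soliton_field c1 c2 c3 c4 c5 p = gradient F4_metric f p"
    by blast
  \<comment> \<open>The plus sign before \<open>s\<close> absorbs the minus sign of the y-component
    of the field.\<close>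
  define u where "u x y s = 1/2 * ((c2 - 12) * x + 2 * c3 * y + 2 * c5)
      + s * (1/2 * (c1 * x + (c2 + 12) * y - 2 * c4))" for x y s
  have diff: "f differentiable (at p)" if "p \<in> F4" for p
    using smooth_on_differentiable_at[OF smooth open_F4 that] .
  have df: "frechet_derivative f (at p) v = F4_metric p (F4_soliton_field c1 c2 c3 c4 c5 p) v"
    if "p \<in> F4" for p v
    using F4_metric_gradient[OF that diff[OF that]] grad[OF that] by simp
  have u0: "u x y s = 0" for x y s
  proof (rule F4_gradient_potential_component_eq_0
      [where u = u and w = "\<lambda>s t. (c1 * s + c2) * t / (4 * t\<^sup>2)"])
    show "f differentiable (at p)" if "p \<in> F4" for p
      using diff[OF that] .
  next
    fix x y s t :: real assume t: "t > 0"
    then have p: "vector [x, y, s, t] \<in> F4" by (simp add: F4_def)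
    show "frechet_derivative f (at (vector [x, y, s, t])) (axis 1 1) = u x y s / t"
      using t by (simp add: df[OF p] F4_metric_axis_1[OF p] F4_soliton_field_def u_def)
    show "frechet_derivative f (at (vector [x, y, s, t])) (axis 4 1)
        = (c1 * s + c2) * t / (4 * t\<^sup>2)"
      by (simp add: df[OF p] F4_metric_axis_4 F4_soliton_field_def)
  qed
  show False
    \<comment> \<open>In order these give c5 = 0, c2 = 12, c3 = 0, c4 = 0 and finally c2 =
      -12.\<close>
    using u0[of 0 0 0] u0[of 1 0 0] u0[of 0 1 0] u0[of 0 0 1] u0[of 0 1 1]
    by (simp add: u_def)
qed

end
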